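(* Let $X$ be a metric space containing twins $x\ne y$ with $d(x,y)=1$, and suppose that $d(x,z)\ge 1$ for every $z\in X\setminus\{x\}$. Then the map $F\colon\mathcal{K}(X)\to\mathcal{K}(X)$ defined by $$F(A)=\begin{cases}\{x,y\},&A=\{x\},\\ \{x\},&A=\{x,y\},\\ A,&\text{otherwise,}\end{cases}$$ is an isometry of $\mathcal{K}(X)$ which does not map the set of singletons onto itself. In particular, $F$ is not induced by any isometry of $X$; that is, there is no isometry $f$ of $X$ with $F(A)=f[A]$ for all $A\in\mathcal{K}(X)$.
   Context: Two points $x\ne y$ of a metric space $X$ are twins if $d(x,z)=d(y,z)$ for every $z\in X\setminus\{x,y\}$. $\mathcal{K}(X)$ is the set of nonempty compact subsets of $X$ with the Hausdorff metric $d_H(A,B)=\max\{\sup_{a\in A}d(a,B),\sup_{b\in B}d(b,A)\}$. *)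

theory Defs
  imports "HOL-Analysis.Analysis"
begin

definition twins :: "'a::metric_space \<Rightarrow> 'a \<Rightarrow> bool" where
  "twins x y \<longleftrightarrow> x \<noteq> y \<and> (\<forall>z\<in>UNIV - {x, y}. dist x z = dist y z)"

definition compacta :: "'a::metric_space set set" where
  "compacta = {A. A \<noteq> {} \<and> compact A}"

(* The real-valued suprema are only meaningful for nonempty bounded arguments,
   in particular on compacta. *)
definition hausdorff_dist :: "'a::metric_space set \<Rightarrow> 'a set \<Rightarrow> real" where
  "hausdorff_dist A B = max (SUP a\<in>A. infdist a B) (SUP b\<in>B. infdist b A)"

(* An isometry of a space is a distance-preserving bijection of the space onto itself. *)
definition isometry_of :: "'b set \<Rightarrow> ('b \<Rightarrow> 'b \<Rightarrow> real) \<Rightarrow> ('b \<Rightarrow> 'b) \<Rightarrow> bool" where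
  "isometry_of S d f \<longleftrightarrow> bij_betw f S S \<and> (\<forall>a\<in>S. \<forall>b\<in>S. d (f a) (f b) = d a b)"

definition twin_swap :: "'a \<Rightarrow> 'a \<Rightarrow> 'a set \<Rightarrow> 'a set" where
  "twin_swap x y A = (if A = {x} then {x, y} else if A = {x, y} then {x} else A)"

end

theory Submission
  imports Defs
begin

text \<open>
  The map exchanges two points of the hyperspace and fixes all others, so it is an isometry as soon
  as \<open>{x}\<close> and \<open>{x, y}\<close> have the same Hausdorff distance to every other compact set \<open>B\<close>. For
  \<open>B = {y}\<close> both distances are \<open>1\<close>. Otherwise \<open>B\<close> contains some \<open>z\<close> outside \<open>{x, y}\<close>. Its distance
  to \<open>x\<close> and to \<open>y\<close> is the same number, at least \<open>1\<close>. Then both distances equal the largest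
  distance from \<open>x\<close> to a point of \<open>B\<close>: the only point of \<open>B\<close> that \<open>{x, y}\<close> can approximate better
  than \<open>{x}\<close> does is \<open>y\<close> itself, whose distance \<open>1\<close> to \<open>x\<close> is already dominated by that of \<open>z\<close>; and
  \<open>z\<close> approximates \<open>y\<close> as well as it approximates \<open>x\<close>, so the extra point costs nothing.

  The remaining claims hold because the singleton \<open>{x}\<close> is sent to the two-point set \<open>{x, y}\<close>,
  whereas the image of a singleton under any point map is a singleton.
\<close>

lemma infdist_pair: "infdist b {x, y} = min (dist b x) (dist b y)"
  by (simp add: infdist_def cInf_eq_Min)

lemma bdd_above_infdist_image:
  assumes "bounded A"
  shows "bdd_above ((\<lambda>a. infdist a B) ` A)"
proof (cases "B = {}")
  case False
  then obtain b where b: "b \<in> B" by blast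
  obtain e where "\<forall>a\<in>A. dist b a \<le> e"
    using assms bounded_any_center[of A b] by blast
  then have "\<forall>a\<in>A. infdist a B \<le> e"
    using b infdist_le2 by (metis dist_commute)
  then show ?thesis by (auto intro: bdd_aboveI2)
qed (auto simp: infdist_def intro: bdd_aboveI2[where M = 0])

text \<open>
  Two Hausdorff distances agree if they have the same upper bounds, and an upper bound can be tested
  point by point. Compactness bounds the suprema, which are taken in the reals.
\<close>

lemma hausdorff_dist_le_iff:
  assumes "A \<in> compacta" "B \<in> compacta"
  shows "hausdorff_dist A B \<le> r \<longleftrightarrow> (\<forall>a\<in>A. infdist a B \<le> r) \<and> (\<forall>b\<in>B. infdist b A \<le> r)"
proof -
  have "A \<noteq> {}" "B \<noteq> {}" "bounded A" "bounded B"
    using assms by (auto simp: compacta_def compact_imp_bounded)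
  then show ?thesis
    by (simp add: hausdorff_dist_def cSUP_le_iff bdd_above_infdist_image)
qed

lemma hausdorff_dist_commute: "hausdorff_dist A B = hausdorff_dist B A"
  by (simp add: hausdorff_dist_def max.commute)

lemma hausdorff_dist_self: "A \<noteq> {} \<Longrightarrow> hausdorff_dist A A = 0"
  by (simp add: hausdorff_dist_def)

text \<open>
  If \<open>B\<close> contains a third point \<open>z\<close>, both distances are at most \<open>r\<close> exactly when every point of
  \<open>B\<close> lies within \<open>r\<close> of \<open>x\<close>. The point \<open>z\<close> serves twice: it keeps \<open>x\<close> and \<open>y\<close> close to \<open>B\<close>, and
  it makes the condition at \<open>b = y\<close> redundant because it is at least as far from \<open>x\<close> as \<open>y\<close> is.
\<close>

lemma hausdorff_dist_singleton_eq_pair: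
  fixes x y :: "'a::metric_space"
  assumes tw: "twins x y" and one: "dist x y = 1" and far: "\<forall>z\<in>UNIV - {x}. dist x z \<ge> 1"
    and B: "B \<in> compacta" "B \<noteq> {x}" "B \<noteq> {x, y}"
  shows "hausdorff_dist {x} B = hausdorff_dist {x, y} B"
proof (cases "B = {y}")
  case True
  then show ?thesis using one by (simp add: hausdorff_dist_def infdist_pair dist_commute cSup_eq_Max)
next
  case False
  then obtain z where z: "z \<in> B" "z \<noteq> x" "z \<noteq> y"
    using B by (auto simp: compacta_def)
  have eq: "dist b x = dist b y" if "b \<notin> {x, y}" for b
    using tw that by (auto simp: twins_def dist_commute)
  have inf_pair: "infdist b {x, y} = (if b = y then 0 else dist b x)" for b
    using eq[of b] by (cases "b = x") (auto simp: infdist_pair)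
  have comp: "{x} \<in> compacta" "{x, y} \<in> compacta"
    by (auto simp: compacta_def)
  have near_z: "infdist x B \<le> dist z x" "infdist y B \<le> dist z x"
    using infdist_le[OF z(1), of x] infdist_le[OF z(1), of y] eq[of z] z
    by (simp_all add: dist_commute)
  have dom: "dist y x \<le> dist z x"
    using one far z by (metis DiffI UNIV_I dist_commute singletonD)
  have "hausdorff_dist {x} B \<le> r \<longleftrightarrow> hausdorff_dist {x, y} B \<le> r" for r
  proof -
    have "hausdorff_dist {x} B \<le> r \<longleftrightarrow> (\<forall>b\<in>B. dist b x \<le> r)"
      using near_z z by (auto simp: hausdorff_dist_le_iff[OF comp(1) B(1)] intro: order_trans)
    also have "\<dots> \<longleftrightarrow> (\<forall>b\<in>B. b \<noteq> y \<longrightarrow> dist b x \<le> r)"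
      using dom z by (metis order_trans)
    also have "\<dots> \<longleftrightarrow> hausdorff_dist {x, y} B \<le> r"
    proof
      assume *: "\<forall>b\<in>B. b \<noteq> y \<longrightarrow> dist b x \<le> r"
      then have r: "dist z x \<le> r" using z by blast
      \<comment> \<open>Needed at \<open>b = y\<close>, whose distance to \<open>{x, y}\<close> is \<open>0\<close>.\<close>
      then have "0 \<le> r" using zero_le_dist order_trans by blast
      then show "hausdorff_dist {x, y} B \<le> r"
        using * r near_z by (auto simp: hausdorff_dist_le_iff[OF comp(2) B(1)] inf_pair)
    next
      assume "hausdorff_dist {x, y} B \<le> r"
      then show "\<forall>b\<in>B. b \<noteq> y \<longrightarrow> dist b x \<le> r"
        by (auto simp: hausdorff_dist_le_iff[OF comp(2) B(1)] inf_pair split: if_splits)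
    qed
    finally show ?thesis .
  qed
  then show ?thesis by (meson order.antisym order.refl)
qed

lemma bij_betw_twin_swap: "bij_betw (twin_swap x y) compacta compacta"
  by (rule bij_betw_byWitness[where f' = "twin_swap x y"])
    (auto simp: twin_swap_def compacta_def)

theorem lemma4p14:
  fixes x y :: "'a::metric_space"
  assumes "twins x y"
    and "dist x y = 1"
    and "\<forall>z\<in>UNIV - {x}. dist x z \<ge> 1"
  shows "isometry_of compacta hausdorff_dist (twin_swap x y)
    \<and> twin_swap x y ` range (\<lambda>z. {z}) \<noteq> range (\<lambda>z. {z})
    \<and> \<not> (\<exists>f :: 'a \<Rightarrow> 'a. isometry_of UNIV dist f \<and> (\<forall>A\<in>compacta. twin_swap x y A = f ` A))"
proof (intro conjI)
  note key = hausdorff_dist_singleton_eq_pair[OF assms]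
  let ?F = "twin_swap x y"
  have half: "hausdorff_dist (?F A) B = hausdorff_dist A B"
    if "B \<in> compacta" "B \<noteq> {x}" "B \<noteq> {x, y}" for A B
    using key[OF that] by (simp add: twin_swap_def)
  have fixed: "?F A = A" if "A \<noteq> {x}" "A \<noteq> {x, y}" for A
    using that by (simp add: twin_swap_def)
  have "hausdorff_dist (?F A) (?F B) = hausdorff_dist A B"
    if AB: "A \<in> compacta" "B \<in> compacta" for A B
  proof (cases "B = {x} \<or> B = {x, y}")
    case False
    then show ?thesis using half AB fixed by metis
  next
    case B: True
    show ?thesis
    proof (cases "A = {x} \<or> A = {x, y}")
      case False
      then show ?thesis using half AB fixed hausdorff_dist_commute by metis
    next
      case True
      with B show ?thesis
        by (elim disjE)
          (simp_all add: twin_swap_def hausdorff_dist_self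
            hausdorff_dist_commute[of "{x, y}" "{x}"])
    qed
  qed
  then show "isometry_of compacta hausdorff_dist (twin_swap x y)"
    by (simp add: isometry_of_def bij_betw_twin_swap)
  have not_singleton: "twin_swap x y {x} \<noteq> {z}" for z
    using assms(1) by (auto simp: twin_swap_def twins_def)
  have "?F {x} \<in> ?F ` range (\<lambda>z. {z})"
    by (intro imageI rangeI)
  moreover have "?F {x} \<notin> range (\<lambda>z. {z})"
    using not_singleton by (simp add: image_iff)
  ultimately show "?F ` range (\<lambda>z. {z}) \<noteq> range (\<lambda>z. {z})"
    by metis
  have "{x} \<in> compacta"
    by (simp add: compacta_def)
  then show "\<not> (\<exists>f :: 'a \<Rightarrow> 'a. isometry_of UNIV dist f \<and> (\<forall>A\<in>compacta. twin_swap x y A = f ` A))"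
    using not_singleton by (metis image_empty image_insert)
qed

end
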